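(* Let $f:[0,\infty)\to E^1$ be a continuous fuzzy-number-valued function, let $s(t)=\int_0^t f(x)\,dx$, and suppose that the integral $\int_0^\infty f(x)\,dx$ is Cesàro summable to a fuzzy number $L\in E^1$. Then $\int_0^\infty f(x)\,dx$ converges to $L$ if and only if for every $\varepsilon>0$ there exist $t_0\ge 0$, $\lambda>1$ and $0<\ell<1$ such that for all $t>t_0$ $$\frac{1}{\lambda t-t}\int_t^{\lambda t}s(x)\,dx\succeq s(t)-\overline{\varepsilon}$$ and $$\frac{1}{t-\ell t}\int_{\ell t}^{t}s(x)\,dx\preceq s(t)+\overline{\varepsilon}.$$
   Context: A fuzzy number is a function $u:\mathbb{R}\to[0,1]$ that is normal ($u(t)=1$ for some $t$), fuzzy convex ($u(ct+(1-c)t')\ge\min\{u(t),u(t')\}$ for $c\in[0,1]$), upper semicontinuous, and such that $\overline{\{t\in\mathbb{R}:u(t)>0\}}$ is compact. $E^1$ is the set of fuzzy numbers. For $\alpha\in(0,1]$ the level set is $[u]_\alpha=\{t:u(t)\ge\alpha\}$, and $[u]_0=\overline{\{t:u(t)>0\}}$; these are compact intervals written $[u]_\alpha=[u_\alpha^-,u_\alpha^+]$. For $r\in\mathbb{R}$, $\overline{r}\in E^1$ is the indicator function of $\{r\}$. Addition and multiplication by $k\in\mathbb{R}$ are defined levelwise: $[u+v]_\alpha=[u_\alpha^-+v_\alpha^-,u_\alpha^++v_\alpha^+]$ and $[ku]_\alpha=k[u]_\alpha$; $u-\overline{\varepsilon}$ means $u+\overline{-\varepsilon}$. The metric on $E^1$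 is $D(u,v)=\sup_{\alpha\in[0,1]}\max\{|u_\alpha^--v_\alpha^-|,|u_\alpha^+-v_\alpha^+|\}$; continuity and limits of $E^1$-valued functions are with respect to $D$. The partial order is: $u\preceq v$ (equivalently $v\succeq u$) iff $u_\alpha^-\le v_\alpha^-$ and $u_\alpha^+\le v_\alpha^+$ for all $\alpha\in[0,1]$. Integrals of $E^1$-valued functions are fuzzy Riemann integrals: $I\in E^1$ is $\int_a^b f(x)\,dx$ if for each $\varepsilon>0$ there is $\delta>0$ such that every Riemann sum $\sum_i f(\xi_i)(x_{i+1}-x_i)$ over a partition of $[a,b]$ of norm less than $\delta$ with tags $\xi_i\in[x_i,x_{i+1}]$ is at $D$-distance less than $\varepsilon$ from $I$. (For continuous $f$ it exists and $[\int_a^b f]_\alpha=[\int_a^b f_\alpha^-,\int_a^b f_\alpha^+]$, where $[f(x)]_\alpha=[f_\alpha^-(x),f_\alpha^+(x)]$.) The integral $\int_0^\infty f(x)\,dx$ converges to $L\in E^1$ if $\lim_{t\to\infty}\int_0^t f(x)\,dx=L$. For continuous $f:[0,\infty)\to E^1$ and $s(t)=\int_0^t f(x)\,dx$, the Cesàro means are $\sigma(t)=\frac1t\int_0^t s(u)\,du$, $t\in(0,\infty)$. The integral $\int_0^\infty f(x)\,dx$ is Cesàro summable to $L\in E^1$ if $\lim_{t\to\infty}\sigma(t)=L$. *)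

theory Defs
  imports "HOL-Analysis.Analysis"
begin

section \<open>Fuzzy numbers\<close>

definition fuzzy_convex :: "(real \<Rightarrow> real) \<Rightarrow> bool" where
  "fuzzy_convex u \<longleftrightarrow>
     (\<forall>t t' c. 0 \<le> c \<and> c \<le> 1 \<longrightarrow> min (u t) (u t') \<le> u (c * t + (1 - c) * t'))"

definition upper_semicontinuous :: "(real \<Rightarrow> real) \<Rightarrow> bool" where
  "upper_semicontinuous u \<longleftrightarrow> (\<forall>x y. u x < y \<longrightarrow> (\<forall>\<^sub>F t in nhds x. u t < y))"

definition is_fuzzy_number :: "(real \<Rightarrow> real) \<Rightarrow> bool" where
  "is_fuzzy_number u \<longleftrightarrow>
     (\<forall>t. 0 \<le> u t \<and> u t \<le> 1) \<and> (\<exists>t. u t = 1) \<and> fuzzy_convex u \<and>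
     upper_semicontinuous u \<and> compact (closure {t. u t > 0})"

lemma usc_superlevel_closed:
  assumes "upper_semicontinuous u" shows "closed {t. a \<le> u t}"
proof -
  have "open {t. u t < a}"
    unfolding open_subopen[of "{t. u t < a}"]
    using assms unfolding upper_semicontinuous_def eventually_nhds by fast
  moreover have "- {t. a \<le> u t} = {t. u t < a}" by auto
  ultimately show ?thesis by (simp add: closed_def)
qed

lemma is_fuzzy_number_indicator: "is_fuzzy_number (indicator {r})"
proof -
  have s: "{t. (indicator {r} t :: real) > 0} = {r}" by (auto simp: indicator_def)
  have "fuzzy_convex (indicator {r})"
    unfolding fuzzy_convex_def by (auto simp: indicator_def algebra_simps)
  moreover have "upper_semicontinuous (indicator {r})"
    unfolding upper_semicontinuous_def
  proof (intro allI impI)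
    fix x y :: real assume a: "indicator {r} x < y"
    show "\<forall>\<^sub>F t in nhds x. indicator {r} t < y"
    proof (cases "x = r")
      case True
      then show ?thesis using a by (auto simp: indicator_def intro!: always_eventually)
    next
      case False
      then have "\<forall>\<^sub>F t in nhds x. t \<in> - {r}" by (intro eventually_nhds_in_open) auto
      then show ?thesis by eventually_elim (use a False in auto)
    qed
  qed
  ultimately show ?thesis unfolding is_fuzzy_number_def s by (auto simp: indicator_def)
qed

text \<open>The type \<open>fuzzy\<close> is the space of fuzzy numbers usually denoted by E with exponent 1;
  \<open>membership\<close> maps a fuzzy number to its underlying function.\<close>

typedef fuzzy = "{u. is_fuzzy_number u}" morphisms membership Abs_fuzzy
  using is_fuzzy_number_indicator by blast

definition level :: "fuzzy \<Rightarrow> real \<Rightarrow> real set" where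
  "level u \<alpha> = (if \<alpha> = 0 then closure {t. membership u t > 0} else {t. membership u t \<ge> \<alpha>})"

definition lower :: "fuzzy \<Rightarrow> real \<Rightarrow> real" where
  "lower u \<alpha> = Inf (level u \<alpha>)"

definition upper :: "fuzzy \<Rightarrow> real \<Rightarrow> real" where
  "upper u \<alpha> = Sup (level u \<alpha>)"

definition crisp :: "real \<Rightarrow> fuzzy" where
  "crisp r = Abs_fuzzy (indicator {r})"


subsection \<open>Level sets are compact intervals\<close>

lemma membership: "is_fuzzy_number (membership u)"
  using membership by simp

lemma membership_range: "0 \<le> membership u t" "membership u t \<le> 1"
  using membership[of u] unfolding is_fuzzy_number_def by auto

lemma level_antimono:
  assumes "0 \<le> \<alpha>" "\<alpha> \<le> \<beta>" shows "level u \<beta> \<subseteq> level u \<alpha>"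
proof (cases "\<alpha> = 0 \<and> \<beta> > 0")
  case True
  then have "level u \<beta> \<subseteq> {t. membership u t > 0}" by (auto simp: level_def)
  then show ?thesis using True closure_subset by (fastforce simp: level_def)
qed (use assms in \<open>auto simp: level_def\<close>)

lemma level_eq_interval:
  assumes "\<alpha> \<in> {0..1}"
  shows "lower u \<alpha> \<le> upper u \<alpha>" and "level u \<alpha> = {lower u \<alpha>..upper u \<alpha>}"
proof -
  note m = membership[of u, unfolded is_fuzzy_number_def]
  have cv: "is_interval {t. a \<le> membership u t}" for a
    unfolding is_interval_convex_1 convex_alt
  proof (clarsimp)
    fix x y c :: real
    assume *: "a \<le> membership u x" "a \<le> membership u y" "0 \<le> c" "c \<le> 1"
    have "min (membership u y) (membership u x) \<le> membership u (c * y + (1 - c) * x)"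
      using m * unfolding fuzzy_convex_def by blast
    then show "a \<le> membership u ((1 - c) * x + c * y)" using * by (simp add: add.commute)
  qed
  have cv0: "convex {t. 0 < membership u t}"
    unfolding convex_alt
  proof (clarsimp)
    fix x y c :: real
    assume *: "0 < membership u x" "0 < membership u y" "0 \<le> c" "c \<le> 1"
    have "min (membership u y) (membership u x) \<le> membership u (c * y + (1 - c) * x)"
      using m * unfolding fuzzy_convex_def by blast
    then show "0 < membership u ((1 - c) * x + c * y)" using * by (simp add: add.commute)
  qed
  have c0: "compact (level u 0)" using m by (simp add: level_def)
  have cl: "closed (level u \<alpha>)"
    using usc_superlevel_closed m by (simp add: level_def)
  have "compact (level u \<alpha>)"
    using compact_Int_closed[OF c0 cl] level_antimono[of 0 \<alpha> u] assms
    by (simp add: Int_absorb1)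
  moreover have "connected (level u \<alpha>)"
    using cv[of \<alpha>] cv0
    by (auto simp: level_def is_interval_connected_1 intro!: convex_connected convex_closure)
  ultimately obtain a b where ab: "level u \<alpha> = {a..b}"
    using connected_compact_interval_1 by (metis cbox_interval)
  obtain t where "membership u t = 1" using m by blast
  then have "t \<in> level u 1" by (simp add: level_def)
  then have "t \<in> level u \<alpha>" using level_antimono[of \<alpha> 1 u] assms by auto
  then have "a \<le> b" using ab by auto
  then show "lower u \<alpha> \<le> upper u \<alpha>" "level u \<alpha> = {lower u \<alpha>..upper u \<alpha>}"
    using ab by (auto simp: lower_def upper_def)
qed

lemma lower_upper_mono:
  assumes "0 \<le> \<alpha>" "\<alpha> \<le> \<beta>" "\<beta> \<le> 1"
  shows "lower u \<alpha> \<le> lower u \<beta>" "upper u \<beta> \<le> upper u \<alpha>"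
  using level_antimono[OF assms(1,2), of u] level_eq_interval[of \<alpha> u] level_eq_interval[of \<beta> u] assms
  by auto

lemma lower_upper_left:
  assumes "0 < \<alpha>" "\<alpha> \<le> 1" "0 < e"
  shows "\<exists>\<beta>. 0 < \<beta> \<and> \<beta> < \<alpha> \<and> lower u \<alpha> - e < lower u \<beta>"
    and "\<exists>\<beta>. 0 < \<beta> \<and> \<beta> < \<alpha> \<and> upper u \<beta> < upper u \<alpha> + e"
proof -
  have mem: "x \<in> level u \<alpha>" if "\<And>\<beta>. 0 < \<beta> \<Longrightarrow> \<beta> < \<alpha> \<Longrightarrow> x \<in> level u \<beta>" for x
  proof -
    have "\<beta> \<le> membership u x" if "0 < \<beta>" "\<beta> < \<alpha>" for \<beta>
      using \<open>\<And>\<beta>. 0 < \<beta> \<Longrightarrow> \<beta> < \<alpha> \<Longrightarrow> x \<in> level u \<beta>\<close>[OF that] that by (simp add: level_def)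
    then have "\<alpha> \<le> membership u x" using assms(1) dense_le_bounded by blast
    then show ?thesis using assms by (simp add: level_def)
  qed
  have iv: "level u \<beta> = {lower u \<beta>..upper u \<beta>}" "lower u \<alpha> \<le> upper u \<alpha>"
    "lower u \<beta> \<le> lower u \<alpha>" "upper u \<alpha> \<le> upper u \<beta>"
    if "0 < \<beta>" "\<beta> \<le> \<alpha>" for \<beta>
    using level_eq_interval lower_upper_mono[of \<beta> \<alpha> u] that assms by auto
  show "\<exists>\<beta>. 0 < \<beta> \<and> \<beta> < \<alpha> \<and> lower u \<alpha> - e < lower u \<beta>"
  proof (rule ccontr)
    assume "\<not> ?thesis"
    then have *: "lower u \<beta> \<le> lower u \<alpha> - e" if "0 < \<beta>" "\<beta> < \<alpha>" for \<beta>
      using that by fastforce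
    have "lower u \<alpha> - e \<in> level u \<alpha>"
    proof (rule mem)
      fix \<beta> assume "0 < \<beta>" "\<beta> < \<alpha>"
      then show "lower u \<alpha> - e \<in> level u \<beta>" using *[of \<beta>] iv[of \<beta>] assms by auto
    qed
    then show False using iv[of \<alpha>] assms by auto
  qed
  show "\<exists>\<beta>. 0 < \<beta> \<and> \<beta> < \<alpha> \<and> upper u \<beta> < upper u \<alpha> + e"
  proof (rule ccontr)
    assume "\<not> ?thesis"
    then have *: "upper u \<alpha> + e \<le> upper u \<beta>" if "0 < \<beta>" "\<beta> < \<alpha>" for \<beta>
      using that by fastforce
    have "upper u \<alpha> + e \<in> level u \<alpha>"
    proof (rule mem)
      fix \<beta> assume "0 < \<beta>" "\<beta> < \<alpha>"
      then show "upper u \<alpha> + e \<in> level u \<beta>" using *[of \<beta>] iv[of \<beta>] assms by auto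
    qed
    then show False using iv[of \<alpha>] assms by auto
  qed
qed

lemma lower_upper_right_0:
  assumes "0 < e"
  shows "\<exists>\<alpha>. 0 < \<alpha> \<and> \<alpha> \<le> 1 \<and> lower u \<alpha> < lower u 0 + e"
    and "\<exists>\<alpha>. 0 < \<alpha> \<and> \<alpha> \<le> 1 \<and> upper u 0 - e < upper u \<alpha>"
proof -
  have near: "\<exists>t \<alpha>. 0 < \<alpha> \<and> \<alpha> \<le> 1 \<and> t \<in> {lower u \<alpha>..upper u \<alpha>} \<and> dist t x < e"
    if "x \<in> level u 0" for x
  proof -
    have "x \<in> closure {t. membership u t > 0}" using that by (simp add: level_def)
    then obtain t where t: "membership u t > 0" "dist t x < e"
      using assms by (auto simp: closure_approachable)
    have "t \<in> level u (membership u t)" using t by (simp add: level_def)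
    then show ?thesis using t membership_range[of u t] level_eq_interval(2)[of "membership u t" u]
      by (metis atLeastAtMost_iff)
  qed
  show "\<exists>\<alpha>. 0 < \<alpha> \<and> \<alpha> \<le> 1 \<and> lower u \<alpha> < lower u 0 + e"
    using near[of "lower u 0"] level_eq_interval[of 0 u] by (fastforce simp: dist_real_def)
  show "\<exists>\<alpha>. 0 < \<alpha> \<and> \<alpha> \<le> 1 \<and> upper u 0 - e < upper u \<alpha>"
    using near[of "upper u 0"] level_eq_interval[of 0 u] by (fastforce simp: dist_real_def)
qed

lemma fuzzy_eqI:
  assumes "\<And>\<alpha>. \<alpha> \<in> {0..1} \<Longrightarrow> level u \<alpha> = level v \<alpha>" shows "u = v"
proof -
  have le: "membership p t \<le> membership q t"
    if "\<And>\<alpha>. \<alpha> \<in> {0..1} \<Longrightarrow> level p \<alpha> = level q \<alpha>" for p q t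
  proof (cases "membership p t = 0")
    case False
    then show ?thesis
      using that[of "membership p t"] membership_range[of p t] by (auto simp: level_def set_eq_iff)
  qed (simp add: membership_range)
  have "membership u t = membership v t" for t
    using le[of u v t] le[of v u t] assms by fastforce
  then show ?thesis using membership_inject by blast
qed

lemma fuzzy_eqI_endpoints:
  assumes "\<And>\<alpha>. \<alpha> \<in> {0..1} \<Longrightarrow> lower u \<alpha> = lower v \<alpha>"
    and "\<And>\<alpha>. \<alpha> \<in> {0..1} \<Longrightarrow> upper u \<alpha> = upper v \<alpha>"
  shows "u = v"
  using assms level_eq_interval(2) by (intro fuzzy_eqI) simp

lemma endpoints_eqI:
  assumes "level w \<alpha> = {a..b}" "a \<le> b" shows "lower w \<alpha> = a" "upper w \<alpha> = b"
  using assms by (auto simp: lower_def upper_def)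

lemma membership_crisp: "membership (crisp r) = indicator {r}"
  by (simp add: crisp_def Abs_fuzzy_inverse is_fuzzy_number_indicator)

lemma level_crisp:
  assumes "\<alpha> \<in> {0..1}" shows "level (crisp r) \<alpha> = {r}"
proof -
  have "{t. (indicator {r} t :: real) > 0} = {r}" by (auto simp: indicator_def)
  then show ?thesis using assms
    by (auto simp: level_def membership_crisp indicator_def split: if_splits)
qed

lemma endpoints_crisp:
  assumes "\<alpha> \<in> {0..1}" shows "lower (crisp r) \<alpha> = r" "upper (crisp r) \<alpha> = r"
  using level_crisp[OF assms] by (auto simp: lower_def upper_def)


subsection \<open>Fuzzy numbers with prescribed level sets\<close>

lemma ex_fuzzy_with_levels:
  fixes L R :: "real \<Rightarrow> real"
  assumes mono: "\<And>\<alpha> \<beta>. 0 \<le> \<alpha> \<Longrightarrow> \<alpha> \<le> \<beta> \<Longrightarrow> \<beta> \<le> 1 \<Longrightarrow> L \<alpha> \<le> L \<beta> \<and> R \<beta> \<le> R \<alpha>"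
    and le: "L 1 \<le> R 1"
    and left: "\<And>\<alpha> e. 0 < \<alpha> \<Longrightarrow> \<alpha> \<le> 1 \<Longrightarrow> 0 < e \<Longrightarrow>
      (\<exists>\<beta>. 0 < \<beta> \<and> \<beta> < \<alpha> \<and> L \<alpha> - e < L \<beta>) \<and> (\<exists>\<beta>. 0 < \<beta> \<and> \<beta> < \<alpha> \<and> R \<beta> < R \<alpha> + e)"
    and right: "\<And>e. 0 < e \<Longrightarrow>
      (\<exists>\<alpha>. 0 < \<alpha> \<and> \<alpha> \<le> 1 \<and> L \<alpha> < L 0 + e) \<and> (\<exists>\<alpha>. 0 < \<alpha> \<and> \<alpha> \<le> 1 \<and> R 0 - e < R \<alpha>)"
  shows "\<exists>!w. \<forall>\<alpha>\<in>{0..1}. level w \<alpha> = {L \<alpha>..R \<alpha>}"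
proof -
  define S where "S t = insert 0 {\<alpha> \<in> {0..1}. L \<alpha> \<le> t \<and> t \<le> R \<alpha>}" for t
  define w where "w t = Sup (S t)" for t
  have bdd: "bdd_above (S t)" for t by (intro bdd_aboveI[of _ 1]) (auto simp: S_def)
  have ne: "S t \<noteq> {}" for t by (auto simp: S_def)
  have w0: "0 \<le> w t" for t unfolding w_def by (intro cSup_upper bdd) (simp add: S_def)
  have w1: "w t \<le> 1" for t unfolding w_def by (intro cSup_least ne) (auto simp: S_def)
  have key: "\<alpha> \<le> w t \<longleftrightarrow> L \<alpha> \<le> t \<and> t \<le> R \<alpha>" if a: "0 < \<alpha>" "\<alpha> \<le> 1" for \<alpha> t
  proof
    assume "L \<alpha> \<le> t \<and> t \<le> R \<alpha>"
    then show "\<alpha> \<le> w t" unfolding w_def using a by (intro cSup_upper bdd) (simp add: S_def)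
  next
    assume "\<alpha> \<le> w t"
    have b: "L \<beta> \<le> t \<and> t \<le> R \<beta>" if "0 < \<beta>" "\<beta> < \<alpha>" for \<beta>
    proof -
      have "\<beta> < Sup (S t)" using that \<open>\<alpha> \<le> w t\<close> by (simp add: w_def)
      then obtain \<gamma> where "\<gamma> \<in> S t" "\<beta> < \<gamma>" using less_cSup_iff[OF ne bdd] by blast
      then show ?thesis using mono[of \<beta> \<gamma>] that by (auto simp: S_def)
    qed
    show "L \<alpha> \<le> t \<and> t \<le> R \<alpha>"
    proof
      show "L \<alpha> \<le> t"
      proof (rule field_le_epsilon)
        fix e :: real assume "0 < e"
        then obtain \<beta> where "0 < \<beta>" "\<beta> < \<alpha>" "L \<alpha> - e < L \<beta>" using left a by blast
        then show "L \<alpha> \<le> t + e" using b[of \<beta>] by linarith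
      qed
      show "t \<le> R \<alpha>"
      proof (rule field_le_epsilon)
        fix e :: real assume "0 < e"
        then obtain \<beta> where "0 < \<beta>" "\<beta> < \<alpha>" "R \<beta> < R \<alpha> + e" using left a by blast
        then show "t \<le> R \<alpha> + e" using b[of \<beta>] by linarith
      qed
    qed
  qed
  have ord: "L \<alpha> \<le> R \<alpha>" if "0 \<le> \<alpha>" "\<alpha> \<le> 1" for \<alpha> using mono[of \<alpha> 1] le that by linarith
  have supp: "closure {t. w t > 0} = {L 0..R 0}"
  proof
    have "{t. w t > 0} \<subseteq> {L 0..R 0}"
    proof
      fix t assume "t \<in> {t. w t > 0}"
      then have "L (w t) \<le> t \<and> t \<le> R (w t)" using key[of "w t" t] w1[of t] by simp
      then show "t \<in> {L 0..R 0}" using mono[of 0 "w t"] w0 w1[of t] by fastforce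
    qed
    then show "closure {t. w t > 0} \<subseteq> {L 0..R 0}" by (simp add: closure_minimal)
    show "{L 0..R 0} \<subseteq> closure {t. w t > 0}"
    proof
      fix t assume t: "t \<in> {L 0..R 0}"
      show "t \<in> closure {t. w t > 0}"
        unfolding closure_approachable
      proof (intro allI impI)
        fix e :: real assume e: "0 < e"
        obtain \<alpha> where a: "0 < \<alpha>" "\<alpha> \<le> 1" "L \<alpha> < L 0 + e" using right e by blast
        obtain \<beta> where b: "0 < \<beta>" "\<beta> \<le> 1" "R 0 - e < R \<beta>" using right e by blast
        define \<gamma> where "\<gamma> = min \<alpha> \<beta>"
        have g: "0 < \<gamma>" "\<gamma> \<le> 1" "L \<gamma> \<le> L \<alpha>" "R \<beta> \<le> R \<gamma>" "L \<gamma> \<le> R \<gamma>"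
          using a b mono[of \<gamma> \<alpha>] mono[of \<gamma> \<beta>] ord[of \<gamma>] by (auto simp: \<gamma>_def)
        define p where "p = max (L \<gamma>) (min t (R \<gamma>))"
        have "\<gamma> \<le> w p" using key[of \<gamma> p] g by (auto simp: p_def)
        moreover have "dist p t < e"
          using t a b g e by (auto simp: p_def dist_real_def max_def min_def)
        ultimately show "\<exists>y\<in>{t. w t > 0}. dist y t < e" using g by force
      qed
    qed
  qed
  have "is_fuzzy_number w"
    unfolding is_fuzzy_number_def
  proof (intro conjI allI)
    show "\<exists>t. w t = 1" using key[of 1 "L 1"] le w1[of "L 1"] by (auto intro: antisym)
    show "compact (closure {t. w t > 0})" by (simp add: supp)
    show "fuzzy_convex w"
      unfolding fuzzy_convex_def
    proof (intro allI impI)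
      fix t t' c :: real assume c: "0 \<le> c \<and> c \<le> 1"
      define m where "m = min (w t) (w t')"
      have "m \<le> w (c * t + (1 - c) * t')"
      proof (cases "m \<le> 0")
        case True
        then show ?thesis using w0 order_trans by blast
      next
        case False
        then have m: "0 < m" "m \<le> 1" using w1[of t] by (auto simp: m_def)
        have "m \<le> w t" "m \<le> w t'" by (simp_all add: m_def)
        then have i: "t \<in> {L m..R m}" "t' \<in> {L m..R m}"
          using key[OF m, of t] key[OF m, of t'] by simp_all
        have "c *\<^sub>R t + (1 - c) *\<^sub>R t' \<in> {L m..R m}"
          using i c by (intro convexD[OF convex_real_interval(5)]) auto
        then show ?thesis using key[OF m, of "c * t + (1 - c) * t'"] by simp
      qed
      then show "min (w t) (w t') \<le> w (c * t + (1 - c) * t')" by (simp only: m_def)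
    qed
    show "upper_semicontinuous w"
      unfolding upper_semicontinuous_def
    proof (intro allI impI)
      fix x y assume xy: "w x < y"
      show "\<forall>\<^sub>F t in nhds x. w t < y"
      proof (cases "y \<le> 1")
        case False
        then show ?thesis using w1 by (intro always_eventually allI) (meson le_less_trans not_le)
      next
        case True
        have y: "0 < y" using xy w0[of x] by linarith
        have "\<forall>\<^sub>F t in nhds x. t \<in> - {L y..R y}"
          using xy key[OF y True, of x] by (intro eventually_nhds_in_open) (auto simp: open_Compl)
        then show ?thesis by eventually_elim (use key[OF y True] in \<open>auto simp: not_le[symmetric]\<close>)
      qed
    qed
  qed (use w0 w1 in auto)
  then have mw: "membership (Abs_fuzzy w) = w" by (simp add: Abs_fuzzy_inverse)
  have "\<forall>\<alpha>\<in>{0..1}. level (Abs_fuzzy w) \<alpha> = {L \<alpha>..R \<alpha>}"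
    using key supp by (auto simp: level_def mw)
  then show ?thesis by (intro ex1I[of _ "Abs_fuzzy w"]) (auto intro: fuzzy_eqI)
qed


section \<open>Order and algebraic operations\<close>

instantiation fuzzy :: order
begin

definition less_eq_fuzzy :: "fuzzy \<Rightarrow> fuzzy \<Rightarrow> bool" where
  "u \<le> v \<longleftrightarrow> (\<forall>\<alpha>\<in>{0..1}. lower u \<alpha> \<le> lower v \<alpha> \<and> upper u \<alpha> \<le> upper v \<alpha>)"

definition less_fuzzy :: "fuzzy \<Rightarrow> fuzzy \<Rightarrow> bool" where
  "u < v \<longleftrightarrow> u \<le> v \<and> \<not> v \<le> u" for u v :: fuzzy

instance
proof
  fix u v w :: fuzzy
  show "u < v \<longleftrightarrow> u \<le> v \<and> \<not> v \<le> u" by (fact less_fuzzy_def)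
  show "u \<le> u" by (simp add: less_eq_fuzzy_def)
  show "u \<le> w" if "u \<le> v" "v \<le> w" using that unfolding less_eq_fuzzy_def by force
  show "u = v" if "u \<le> v" "v \<le> u"
    using that unfolding less_eq_fuzzy_def by (intro fuzzy_eqI_endpoints) (auto intro: antisym)
qed

end

definition fuzzy_add :: "fuzzy \<Rightarrow> fuzzy \<Rightarrow> fuzzy" where
  "fuzzy_add u v = (THE w. \<forall>\<alpha>\<in>{0..1}.
     level w \<alpha> = {lower u \<alpha> + lower v \<alpha>..upper u \<alpha> + upper v \<alpha>})"

lemma level_fuzzy_add:
  assumes "\<alpha> \<in> {0..1}"
  shows "level (fuzzy_add u v) \<alpha> = {lower u \<alpha> + lower v \<alpha>..upper u \<alpha> + upper v \<alpha>}"
proof -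
  have "\<exists>!w. \<forall>\<alpha>\<in>{0..1}. level w \<alpha> = {lower u \<alpha> + lower v \<alpha>..upper u \<alpha> + upper v \<alpha>}"
  proof (rule ex_fuzzy_with_levels, goal_cases)
    case (1 \<alpha> \<beta>)
    then show ?case using lower_upper_mono[OF 1, of u] lower_upper_mono[OF 1, of v] by linarith
  next
    case 2
    then show ?case using level_eq_interval(1)[of 1 u] level_eq_interval(1)[of 1 v] by simp
  next
    case (3 \<alpha> e)
    then have e: "0 < e / 2" by simp
    obtain b c where b: "0 < b" "b < \<alpha>" "lower u \<alpha> - e / 2 < lower u b"
      and c: "0 < c" "c < \<alpha>" "lower v \<alpha> - e / 2 < lower v c"
      using lower_upper_left(1)[OF 3(1,2) e] by blast
    obtain b' c' where b': "0 < b'" "b' < \<alpha>" "upper u b' < upper u \<alpha> + e / 2"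
      and c': "0 < c'" "c' < \<alpha>" "upper v c' < upper v \<alpha> + e / 2"
      using lower_upper_left(2)[OF 3(1,2) e] by blast
    have "lower u b \<le> lower u (max b c)" "lower v c \<le> lower v (max b c)"
      "upper u (max b' c') \<le> upper u b'" "upper v (max b' c') \<le> upper v c'"
      using b c b' c' 3 by (auto intro!: lower_upper_mono)
    then show ?case using b c b' c'
      by (intro conjI exI[of _ "max b c"] exI[of _ "max b' c'"]) (auto simp del: max.bounded_iff)
  next
    case (4 e)
    then have e: "0 < e / 2" by simp
    obtain b c where b: "0 < b" "b \<le> 1" "lower u b < lower u 0 + e / 2"
      and c: "0 < c" "c \<le> 1" "lower v c < lower v 0 + e / 2"
      using lower_upper_right_0(1)[OF e] by blast
    obtain b' c' where b': "0 < b'" "b' \<le> 1" "upper u 0 - e / 2 < upper u b'"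
      and c': "0 < c'" "c' \<le> 1" "upper v 0 - e / 2 < upper v c'"
      using lower_upper_right_0(2)[OF e] by blast
    have "lower u (min b c) \<le> lower u b" "lower v (min b c) \<le> lower v c"
      "upper u b' \<le> upper u (min b' c')" "upper v c' \<le> upper v (min b' c')"
      using b c b' c' by (auto intro!: lower_upper_mono)
    then show ?case using b c b' c'
      by (intro conjI exI[of _ "min b c"] exI[of _ "min b' c'"]) (auto simp: min_le_iff_disj)
  qed
  from theI'[OF this] show ?thesis using assms by (simp add: fuzzy_add_def)
qed

instantiation fuzzy :: comm_monoid_add
begin

definition zero_fuzzy :: fuzzy where "0 = crisp 0"

definition plus_fuzzy :: "fuzzy \<Rightarrow> fuzzy \<Rightarrow> fuzzy" where "u + v = fuzzy_add u v"

lemma endpoints_add: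
  fixes u v :: fuzzy
  assumes "\<alpha> \<in> {0..1}"
  shows "lower (u + v) \<alpha> = lower u \<alpha> + lower v \<alpha>" "upper (u + v) \<alpha> = upper u \<alpha> + upper v \<alpha>"
  unfolding plus_fuzzy_def
  using endpoints_eqI[OF level_fuzzy_add[OF assms, of u v]]
    level_eq_interval(1)[OF assms, of u] level_eq_interval(1)[OF assms, of v] by auto

instance
proof
  fix u v w :: fuzzy
  show "u + v + w = u + (v + w)" by (rule fuzzy_eqI_endpoints) (simp_all add: endpoints_add)
  show "u + v = v + u" by (rule fuzzy_eqI_endpoints) (simp_all add: endpoints_add)
  show "0 + u = u"
    by (rule fuzzy_eqI_endpoints) (simp_all add: endpoints_add endpoints_crisp zero_fuzzy_def)
qed

end

definition fuzzy_scale :: "real \<Rightarrow> fuzzy \<Rightarrow> fuzzy" where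
  "fuzzy_scale k u = (THE w. \<forall>\<alpha>\<in>{0..1}. level w \<alpha> = (\<lambda>t. k * t) ` level u \<alpha>)"

lemma level_fuzzy_scale:
  assumes "\<alpha> \<in> {0..1}"
  shows "level (fuzzy_scale k u) \<alpha> = (\<lambda>t. k * t) ` level u \<alpha>"
proof -
  let ?L = "\<lambda>\<alpha>. if 0 \<le> k then k * lower u \<alpha> else k * upper u \<alpha>"
  let ?R = "\<lambda>\<alpha>. if 0 \<le> k then k * upper u \<alpha> else k * lower u \<alpha>"
  have img: "(\<lambda>t. k * t) ` level u \<alpha> = {?L \<alpha>..?R \<alpha>}" if "\<alpha> \<in> {0..1}" for \<alpha>
    using level_eq_interval[OF that, of u] by (simp add: image_mult_atLeastAtMost_if)
  have ex: "\<exists>!w. \<forall>\<alpha>\<in>{0..1}. level w \<alpha> = {?L \<alpha>..?R \<alpha>}"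
  proof (rule ex_fuzzy_with_levels, goal_cases)
    case (1 \<alpha> \<beta>)
    then show ?case using lower_upper_mono[OF 1, of u]
      by (auto intro: mult_left_mono mult_left_mono_neg)
  next
    case 2
    then show ?case using level_eq_interval(1)[of 1 u]
      by (auto intro: mult_left_mono mult_left_mono_neg)
  next
    case (3 \<alpha> e)
    define d where "d = e / (\<bar>k\<bar> + 1)"
    have d: "0 < d" "\<bar>k\<bar> * d < e" using 3 by (auto simp: d_def field_simps)
    obtain b where b: "0 < b" "b < \<alpha>" "lower u \<alpha> - d < lower u b"
      using lower_upper_left(1)[OF 3(1,2) d(1)] by blast
    obtain b' where b': "0 < b'" "b' < \<alpha>" "upper u b' < upper u \<alpha> + d"
      using lower_upper_left(2)[OF 3(1,2) d(1)] by blast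
    have "\<bar>k\<bar> * (lower u \<alpha> - lower u b) \<le> \<bar>k\<bar> * d" "\<bar>k\<bar> * (upper u b' - upper u \<alpha>) \<le> \<bar>k\<bar> * d"
      using b b' by (auto intro!: mult_left_mono)
    then have "\<bar>k\<bar> * (lower u \<alpha> - lower u b) < e" "\<bar>k\<bar> * (upper u b' - upper u \<alpha>) < e"
      using d by linarith+
    then show ?case using b b' by (cases "0 \<le> k") (auto simp: algebra_simps)
  next
    case (4 e)
    define d where "d = e / (\<bar>k\<bar> + 1)"
    have d: "0 < d" "\<bar>k\<bar> * d < e" using 4 by (auto simp: d_def field_simps)
    obtain b where b: "0 < b" "b \<le> 1" "lower u b < lower u 0 + d"
      using lower_upper_right_0(1)[OF d(1)] by blast
    obtain b' where b': "0 < b'" "b' \<le> 1" "upper u 0 - d < upper u b'"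
      using lower_upper_right_0(2)[OF d(1)] by blast
    have "\<bar>k\<bar> * (lower u b - lower u 0) \<le> \<bar>k\<bar> * d" "\<bar>k\<bar> * (upper u 0 - upper u b') \<le> \<bar>k\<bar> * d"
      using b b' by (auto intro!: mult_left_mono)
    then have "\<bar>k\<bar> * (lower u b - lower u 0) < e" "\<bar>k\<bar> * (upper u 0 - upper u b') < e"
      using d by linarith+
    then show ?case using b b' by (cases "0 \<le> k") (auto simp: algebra_simps)
  qed
  have "(\<forall>\<alpha>\<in>{0..1}. level w \<alpha> = (\<lambda>t. k * t) ` level u \<alpha>) \<longleftrightarrow>
      (\<forall>\<alpha>\<in>{0..1}. level w \<alpha> = {?L \<alpha>..?R \<alpha>})" for w
    using img by (intro ball_cong) auto
  then have "\<exists>!w. \<forall>\<alpha>\<in>{0..1}. level w \<alpha> = (\<lambda>t. k * t) ` level u \<alpha>"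
    using ex by (simp only:)
  from theI'[OF this] show ?thesis using assms by (simp add: fuzzy_scale_def)
qed

text \<open>Fuzzy numbers do not form a real vector space (the law \<open>(a + b) u = a u + b u\<close> fails for
  \<open>a\<close> and \<open>b\<close> of opposite sign), so only the syntactic class of scalar multiplication is
  instantiated.\<close>

instantiation fuzzy :: scaleR
begin

definition scaleR_fuzzy :: "real \<Rightarrow> fuzzy \<Rightarrow> fuzzy" where "k *\<^sub>R u = fuzzy_scale k u"

instance ..

end


section \<open>The metric\<close>

definition fuzzy_dist :: "fuzzy \<Rightarrow> fuzzy \<Rightarrow> real" where
  "fuzzy_dist u v =
     (SUP \<alpha>\<in>{0..1}. max \<bar>lower u \<alpha> - lower v \<alpha>\<bar> \<bar>upper u \<alpha> - upper v \<alpha>\<bar>)"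

lemma fuzzy_dist_bdd:
  "bdd_above ((\<lambda>\<alpha>. max \<bar>lower u \<alpha> - lower v \<alpha>\<bar> \<bar>upper u \<alpha> - upper v \<alpha>\<bar>) ` {0..1})"
proof (rule bdd_aboveI2)
  fix \<alpha> :: real assume a: "\<alpha> \<in> {0..1}"
  have "lower w 0 \<le> lower w \<alpha> \<and> lower w \<alpha> \<le> upper w \<alpha> \<and> upper w \<alpha> \<le> upper w 0" for w
    using lower_upper_mono[of 0 \<alpha> w] level_eq_interval(1)[OF a] a by auto
  from this[of u] this[of v]
  show "max \<bar>lower u \<alpha> - lower v \<alpha>\<bar> \<bar>upper u \<alpha> - upper v \<alpha>\<bar>
    \<le> \<bar>lower u 0\<bar> + \<bar>lower v 0\<bar> + \<bar>upper u 0\<bar> + \<bar>upper v 0\<bar>" by auto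
qed

lemma fuzzy_dist_ge:
  assumes "\<alpha> \<in> {0..1}"
  shows "max \<bar>lower u \<alpha> - lower v \<alpha>\<bar> \<bar>upper u \<alpha> - upper v \<alpha>\<bar> \<le> fuzzy_dist u v"
  unfolding fuzzy_dist_def using fuzzy_dist_bdd assms by (rule cSUP_upper2) simp

lemma fuzzy_dist_le:
  assumes "\<And>\<alpha>. \<alpha> \<in> {0..1} \<Longrightarrow> \<bar>lower u \<alpha> - lower v \<alpha>\<bar> \<le> d \<and> \<bar>upper u \<alpha> - upper v \<alpha>\<bar> \<le> d"
  shows "fuzzy_dist u v \<le> d"
  unfolding fuzzy_dist_def using assms by (intro cSUP_least) auto

instantiation fuzzy :: metric_space
begin

definition dist_fuzzy :: "fuzzy \<Rightarrow> fuzzy \<Rightarrow> real" where "dist u v = fuzzy_dist u v"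

definition uniformity_fuzzy :: "(fuzzy \<times> fuzzy) filter" where
  "uniformity_fuzzy = (INF e\<in>{0<..}. principal {(x, y). dist x y < e})"

definition open_fuzzy :: "fuzzy set \<Rightarrow> bool" where
  "open_fuzzy U \<longleftrightarrow> (\<forall>x\<in>U. \<forall>\<^sub>F (x', y) in uniformity. x' = x \<longrightarrow> y \<in> U)"

instance
proof
  fix u v w :: fuzzy
  show "dist u v = 0 \<longleftrightarrow> u = v"
  proof
    assume d: "dist u v = 0"
    show "u = v"
    proof (rule fuzzy_eqI_endpoints)
      fix \<alpha> :: real assume "\<alpha> \<in> {0..1}"
      then have "max \<bar>lower u \<alpha> - lower v \<alpha>\<bar> \<bar>upper u \<alpha> - upper v \<alpha>\<bar> \<le> 0"
        using fuzzy_dist_ge d by (metis dist_fuzzy_def)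
      then show "lower u \<alpha> = lower v \<alpha>" "upper u \<alpha> = upper v \<alpha>" by auto
    qed
  next
    assume "u = v"
    then show "dist u v = 0" by (simp add: dist_fuzzy_def fuzzy_dist_def)
  qed
  show "dist u v \<le> dist u w + dist v w"
    unfolding dist_fuzzy_def
  proof (rule fuzzy_dist_le)
    fix \<alpha> :: real assume "\<alpha> \<in> {0..1}"
    from fuzzy_dist_ge[OF this, of u w] fuzzy_dist_ge[OF this, of v w]
    show "\<bar>lower u \<alpha> - lower v \<alpha>\<bar> \<le> fuzzy_dist u w + fuzzy_dist v w \<and>
      \<bar>upper u \<alpha> - upper v \<alpha>\<bar> \<le> fuzzy_dist u w + fuzzy_dist v w" by auto
  qed
qed (simp_all add: uniformity_fuzzy_def open_fuzzy_def)

end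


section \<open>Fuzzy Riemann integrals\<close>

text \<open>\<open>x 0 < x 1 < \<dots> < x n\<close> is a partition of \<open>{a..b}\<close> of norm less than \<open>\<delta>\<close> and \<open>\<xi> i\<close> is the
  tag of the subinterval \<open>{x i..x (Suc i)}\<close>.  For \<open>a = b\<close> only \<open>n = 0\<close> is possible, so the
  integral over a degenerate interval is \<open>0\<close>.\<close>

definition tagged_partition ::
  "real \<Rightarrow> real \<Rightarrow> real \<Rightarrow> nat \<Rightarrow> (nat \<Rightarrow> real) \<Rightarrow> (nat \<Rightarrow> real) \<Rightarrow> bool" where
  "tagged_partition a b \<delta> n x \<xi> \<longleftrightarrow>
     x 0 = a \<and> x n = b \<and>
     (\<forall>i<n. x i < x (Suc i) \<and> x (Suc i) - x i < \<delta> \<and> \<xi> i \<in> {x i..x (Suc i)})"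

definition has_fuzzy_integral :: "(real \<Rightarrow> fuzzy) \<Rightarrow> fuzzy \<Rightarrow> real \<Rightarrow> real \<Rightarrow> bool" where
  "has_fuzzy_integral f I a b \<longleftrightarrow>
     (\<forall>\<epsilon>>0. \<exists>\<delta>>0. \<forall>n x \<xi>. tagged_partition a b \<delta> n x \<xi> \<longrightarrow>
        dist (\<Sum>i<n. (x (Suc i) - x i) *\<^sub>R f (\<xi> i)) I < \<epsilon>)"

definition fuzzy_integral :: "real \<Rightarrow> real \<Rightarrow> (real \<Rightarrow> fuzzy) \<Rightarrow> fuzzy" where
  "fuzzy_integral a b f = (THE I. has_fuzzy_integral f I a b)"

definition integral_converges_to :: "(real \<Rightarrow> fuzzy) \<Rightarrow> fuzzy \<Rightarrow> bool" where
  "integral_converges_to f L \<longleftrightarrow> ((\<lambda>t. fuzzy_integral 0 t f) \<longlongrightarrow> L) at_top"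

definition cesaro_mean :: "(real \<Rightarrow> fuzzy) \<Rightarrow> real \<Rightarrow> fuzzy" where
  "cesaro_mean f t = (1 / t) *\<^sub>R fuzzy_integral 0 t (\<lambda>u. fuzzy_integral 0 u f)"

definition cesaro_summable_to :: "(real \<Rightarrow> fuzzy) \<Rightarrow> fuzzy \<Rightarrow> bool" where
  "cesaro_summable_to f L \<longleftrightarrow> (cesaro_mean f \<longlongrightarrow> L) at_top"

end

theory Submission
  imports Defs
begin

text \<open>For fixed \<open>0 < p < q\<close>, the average of \<open>s\<close> over \<open>[p t, q t]\<close> has the endpoint functions of
  \<open>(q \<sigma>(q t) - p \<sigma>(p t)) / (q - p)\<close>, so Cesaro summability alone forces every such moving
  average to converge to \<open>L\<close>. Both one-sided conditions compare \<open>s(t)\<close> with moving averages,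
  the first giving an upper and the second a lower bound for \<open>s(t)\<close>.\<close>

section \<open>Endpoint functions\<close>

text \<open>Treating the endpoint map as a variable \<open>E\<close> lets one real-valued argument
  serve for lower and upper endpoints alike; most later estimates are phrased this way.\<close>

lemma fuzzy_le_iff:
  "u \<le> v \<longleftrightarrow> (\<forall>E\<in>{lower, upper}. \<forall>\<alpha>\<in>{0..1}. E u \<alpha> \<le> E v \<alpha>)"
  by (auto simp: less_eq_fuzzy_def)

lemma endpoint_dist_le:
  assumes "E \<in> {lower, upper}" "\<alpha> \<in> {0..1}"
  shows "\<bar>E u \<alpha> - E v \<alpha>\<bar> \<le> dist u v"
  using fuzzy_dist_ge[OF assms(2), of u v] assms(1) by (auto simp: dist_fuzzy_def)

lemma dist_fuzzy_leI:
  assumes "\<And>E \<alpha>. E \<in> {lower, upper} \<Longrightarrow> \<alpha> \<in> {0..1} \<Longrightarrow> \<bar>E u \<alpha> - E v \<alpha>\<bar> \<le> d"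
  shows "dist u v \<le> d"
  unfolding dist_fuzzy_def using assms by (intro fuzzy_dist_le) auto

lemma endpoint_add:
  assumes "E \<in> {lower, upper}" "\<alpha> \<in> {0..1}"
  shows "E (u + v) \<alpha> = E u \<alpha> + E v \<alpha>"
  using assms endpoints_add by auto

lemma endpoint_crisp:
  assumes "E \<in> {lower, upper}" "\<alpha> \<in> {0..1}"
  shows "E (crisp r) \<alpha> = r"
  using assms endpoints_crisp by auto

text \<open>The sign condition matters, since a negative factor would swap the two endpoints. The
  factors met later are cell lengths and reciprocals of positive lengths.\<close>

lemma endpoint_scaleR:
  assumes "E \<in> {lower, upper}" "\<alpha> \<in> {0..1}" "0 \<le> k"
  shows "E (k *\<^sub>R u) \<alpha> = k * E u \<alpha>"
proof -
  note le = level_eq_interval(1)[OF assms(2), of u]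
  have "level (k *\<^sub>R u) \<alpha> = {k * lower u \<alpha>..k * upper u \<alpha>}"
    using level_fuzzy_scale[OF assms(2), of k u] level_eq_interval(2)[OF assms(2), of u] le assms(3)
    by (simp add: scaleR_fuzzy_def image_mult_atLeastAtMost_if)
  from endpoints_eqI[OF this] show ?thesis
    using assms le by (auto intro: mult_left_mono)
qed

lemma endpoint_sum:
  assumes "E \<in> {lower, upper}" "\<alpha> \<in> {0..1}"
  shows "E (\<Sum>i\<in>A. u i) \<alpha> = (\<Sum>i\<in>A. E (u i) \<alpha>)"
proof (induction A rule: infinite_finite_induct)
  case (insert i A)
  then show ?case by (simp add: endpoint_add[OF assms])
qed (simp_all add: zero_fuzzy_def endpoint_crisp[OF assms])

lemma continuous_on_endpoint:
  assumes "continuous_on S f" "E \<in> {lower, upper}" "\<alpha> \<in> {0..1}"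
  shows "continuous_on S (\<lambda>x. E (f x) \<alpha>)"
  unfolding continuous_on_def
proof
  fix x assume "x \<in> S"
  then have lim: "(f \<longlongrightarrow> f x) (at x within S)" using assms(1) by (simp add: continuous_on_def)
  show "((\<lambda>y. E (f y) \<alpha>) \<longlongrightarrow> E (f x) \<alpha>) (at x within S)"
  proof (rule tendstoI)
    fix e :: real assume "0 < e"
    from tendstoD[OF lim this] show "\<forall>\<^sub>F y in at x within S. dist (E (f y) \<alpha>) (E (f x) \<alpha>) < e"
      unfolding dist_real_def
      by eventually_elim (rule le_less_trans[OF endpoint_dist_le[OF assms(2,3)]])
  qed
qed

section \<open>Passing between the metric and the partial order\<close>

lemma dist_le_imp_fuzzy_bounds:
  assumes "dist u v \<le> e"
  shows "v + crisp (- e) \<le> u" "u \<le> v + crisp e"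
proof -
  have "\<bar>E u \<alpha> - E v \<alpha>\<bar> \<le> e" if "E \<in> {lower, upper}" "\<alpha> \<in> {0..1}" for E \<alpha>
    using endpoint_dist_le[OF that, of u v] assms by linarith
  then show "v + crisp (- e) \<le> u" "u \<le> v + crisp e"
    unfolding fuzzy_le_iff by (fastforce simp: endpoint_add endpoint_crisp abs_le_iff)+
qed

text \<open>This turns one-sided order conditions into a metric bound: on every endpoint
  \<open>w\<close> is at least \<open>u - e\<close>, hence at least \<open>x - d - e\<close>, and at
  most \<open>v + e\<close>, hence at most \<open>x + d + e\<close>.\<close>

lemma dist_le_between:
  assumes "w + crisp (- e) \<le> v" "u \<le> w + crisp e" "dist u x \<le> d" "dist v x \<le> d"
  shows "dist w x \<le> d + e"
proof (rule dist_fuzzy_leI)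
  fix E \<alpha> assume *: "E \<in> {lower, upper}" "\<alpha> \<in> {0..1::real}"
  have "E (w + crisp (- e)) \<alpha> \<le> E v \<alpha>" "E u \<alpha> \<le> E (w + crisp e) \<alpha>"
    using assms(1,2) * unfolding fuzzy_le_iff by blast+
  then show "\<bar>E w \<alpha> - E x \<alpha>\<bar> \<le> d + e"
    using endpoint_dist_le[OF *, of u x] endpoint_dist_le[OF *, of v x] assms(3,4)
    by (simp add: endpoint_add[OF *] endpoint_crisp[OF *])
qed


section \<open>Integrals of continuous functions\<close>

lemma ex_tagged_partition:
  assumes "a \<le> b" "0 < \<delta>"
  shows "\<exists>n x \<xi>. tagged_partition a b \<delta> n x \<xi>"
proof (cases "a = b")
  case True
  \<comment> \<open>Nodes must increase strictly, so on a degenerate interval only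
    \<open>n = 0\<close> is available.\<close>
  then show ?thesis
    by (intro exI[of _ 0] exI[of _ "\<lambda>_. a"]) (simp add: tagged_partition_def)
next
  case False
  then have ab: "0 < b - a" using assms by simp
  obtain m where m: "(b - a) / \<delta> < real m" using reals_Archimedean2 by blast
  have "0 < (b - a) / \<delta>" using ab assms by simp
  then have m0: "0 < real m" using m by linarith
  define h where "h = (b - a) / m"
  have h: "0 < h" "h < \<delta>" "real m * h = b - a"
    using ab m m0 assms by (auto simp: h_def field_simps)
  have "tagged_partition a b \<delta> m (\<lambda>i. a + real i * h) (\<lambda>i. a + real i * h)"
    using h by (auto simp: tagged_partition_def algebra_simps)
  then show ?thesis by blast
qed

text \<open>The error depends on \<open>g\<close> only through its oscillation at scale \<delta>.
  Applied to the endpoint functions of a fuzzy-valued map, it is therefore uniform in the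
  level.\<close>

lemma Riemann_sum_error:
  fixes g :: "real \<Rightarrow> real"
  assumes "tagged_partition a b \<delta> n x \<xi>" "continuous_on {a..b} g"
    and osc: "\<And>y z. y \<in> {a..b} \<Longrightarrow> z \<in> {a..b} \<Longrightarrow> \<bar>y - z\<bar> < \<delta> \<Longrightarrow> \<bar>g y - g z\<bar> \<le> \<eta>"
  shows "\<bar>(\<Sum>i<n. (x (Suc i) - x i) * g (\<xi> i)) - integral {a..b} g\<bar> \<le> \<eta> * (b - a)"
proof -
  note tp = assms(1)[unfolded tagged_partition_def]
  have mono: "x i \<le> x j" if "i \<le> j" "j \<le> n" for i j
    using that
  proof (induction j rule: dec_induct)
    case (step k)
    then have "x k < x (Suc k)" using tp by auto
    then show ?case using step by auto
  qed simp
  have bnd: "a \<le> x i \<and> x i \<le> b" if "i \<le> n" for i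
    using mono[of 0 i] mono[of i n] that tp by auto
  \<comment> \<open>Induction over initial segments of the partition: each cell adds an error of at
    most \<eta> times its length.\<close>
  have "\<bar>(\<Sum>i<k. (x (Suc i) - x i) * g (\<xi> i)) - integral {a..x k} g\<bar> \<le> \<eta> * (x k - a)"
    if "k \<le> n" for k
    using that
  proof (induction k)
    case 0
    then show ?case using tp by simp
  next
    case (Suc k)
    let ?J = "{x k..x (Suc k)}"
    have k: "a \<le> x k" "x k < x (Suc k)" "x (Suc k) \<le> b" "x (Suc k) - x k < \<delta>" "\<xi> k \<in> ?J"
      using Suc.prems tp bnd[of k] bnd[of "Suc k"] by auto
    have int: "g integrable_on {c..d}" if "a \<le> c" "d \<le> b" for c d
      using that by (intro integrable_continuous_interval continuous_on_subset[OF assms(2)]) auto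
    have "integral {a..x (Suc k)} g = integral {a..x k} g + integral ?J g"
      using Henstock_Kurzweil_Integration.integral_combine[of a "x k" "x (Suc k)" g] int k by auto
    moreover have "\<bar>(x (Suc k) - x k) * g (\<xi> k) - integral ?J g\<bar> \<le> \<eta> * (x (Suc k) - x k)"
    proof -
      \<comment> \<open>The summand is the integral of the constant \<open>g (\<xi> k)\<close> over
        the cell. Tag and integration variable share a cell shorter than \<delta>, so
        \<open>osc\<close> applies to the integrand.\<close>
      have "(x (Suc k) - x k) * g (\<xi> k) - integral ?J g = integral ?J (\<lambda>y. g (\<xi> k) - g y)"
        using k int[of "x k" "x (Suc k)"] by (subst integral_diff) (auto simp: mult.commute)
      moreover have "norm (integral ?J (\<lambda>y. g (\<xi> k) - g y)) \<le> \<eta> * (x (Suc k) - x k)"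
      proof (rule integral_bound)
        show "continuous_on ?J (\<lambda>y. g (\<xi> k) - g y)"
          using k by (intro continuous_intros continuous_on_subset[OF assms(2)]) auto
        fix y assume "y \<in> ?J"
        then show "norm (g (\<xi> k) - g y) \<le> \<eta>" using k by (auto intro!: osc)
      qed (use k in auto)
      ultimately show ?thesis by simp
    qed
    ultimately show ?case using Suc by (auto simp: algebra_simps abs_le_iff)
  qed
  from this[of n] show ?thesis using tp by simp
qed

section \<open>Uniqueness and existence of the fuzzy integral\<close>

lemma has_fuzzy_integral_unique:
  assumes "a \<le> b" "has_fuzzy_integral f I a b" "has_fuzzy_integral f J a b"
  shows "I = J"
proof (rule ccontr)
  assume "I \<noteq> J"
  then have e: "0 < dist I J / 2" by simp
  obtain d where d: "0 < d"
    and I: "\<And>n x \<xi>. tagged_partition a b d n x \<xi> \<Longrightarrow>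
      dist (\<Sum>i<n. (x (Suc i) - x i) *\<^sub>R f (\<xi> i)) I < dist I J / 2"
    using assms(2)[unfolded has_fuzzy_integral_def, rule_format, OF e] by blast
  obtain d' where d': "0 < d'"
    and J: "\<And>n x \<xi>. tagged_partition a b d' n x \<xi> \<Longrightarrow>
      dist (\<Sum>i<n. (x (Suc i) - x i) *\<^sub>R f (\<xi> i)) J < dist I J / 2"
    using assms(3)[unfolded has_fuzzy_integral_def, rule_format, OF e] by blast
  \<comment> \<open>A partition fine enough for both candidates gives one Riemann sum close to
    \<open>I\<close> and to \<open>J\<close>.\<close>
  obtain n x \<xi> where "tagged_partition a b (min d d') n x \<xi>"
    using ex_tagged_partition[OF assms(1), of "min d d'"] d d' by auto
  then have "tagged_partition a b d n x \<xi>" "tagged_partition a b d' n x \<xi>"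
    by (auto simp: tagged_partition_def)
  from dist_triangle_half_r[OF I[OF this(1)] J[OF this(2)]] show False by simp
qed

text \<open>One \<delta> serves all levels and both endpoints, because \<open>f\<close> is uniformly
  continuous for the supremum metric and each endpoint map is 1-Lipschitz for it.\<close>

lemma fuzzy_Riemann_sum_error:
  fixes f :: "real \<Rightarrow> fuzzy"
  assumes "a \<le> b" "continuous_on {a..b} f" "0 < \<epsilon>"
  obtains \<delta> where "0 < \<delta>"
    "\<And>n x \<xi> E \<alpha>. tagged_partition a b \<delta> n x \<xi> \<Longrightarrow> E \<in> {lower, upper} \<Longrightarrow> \<alpha> \<in> {0..1} \<Longrightarrow>
      \<bar>E (\<Sum>i<n. (x (Suc i) - x i) *\<^sub>R f (\<xi> i)) \<alpha> - integral {a..b} (\<lambda>x. E (f x) \<alpha>)\<bar> \<le> \<epsilon>"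
proof -
  \<comment> \<open>Adding 1 keeps the denominator positive when \<open>a = b\<close>.\<close>
  define \<eta> where "\<eta> = \<epsilon> / (b - a + 1)"
  have \<eta>: "0 < \<eta>" "\<eta> * (b - a) \<le> \<epsilon>"
    using assms by (auto simp: \<eta>_def field_simps)
  have "uniformly_continuous_on {a..b} f"
    using assms(2) by (intro compact_uniformly_continuous) auto
  then obtain \<delta> where \<delta>: "0 < \<delta>"
    "\<And>y z. y \<in> {a..b} \<Longrightarrow> z \<in> {a..b} \<Longrightarrow> dist y z < \<delta> \<Longrightarrow> dist (f y) (f z) < \<eta>"
    using \<eta>(1) unfolding uniformly_continuous_on_def by metis
  show ?thesis
  proof (rule that[OF \<delta>(1)])
    fix n x \<xi> E \<alpha>
    assume tp: "tagged_partition a b \<delta> n x \<xi>" and E: "E \<in> {lower, upper}" "\<alpha> \<in> {0..1::real}"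
    have "\<bar>E (f y) \<alpha> - E (f z) \<alpha>\<bar> \<le> \<eta>" if "y \<in> {a..b}" "z \<in> {a..b}" "\<bar>y - z\<bar> < \<delta>" for y z
      using endpoint_dist_le[OF E, of "f y" "f z"] \<delta>(2)[of y z] that by (simp add: dist_real_def)
    from Riemann_sum_error[OF tp continuous_on_endpoint[OF assms(2) E] this]
    have "\<bar>(\<Sum>i<n. (x (Suc i) - x i) * E (f (\<xi> i)) \<alpha>) - integral {a..b} (\<lambda>x. E (f x) \<alpha>)\<bar>
        \<le> \<eta> * (b - a)" .
    moreover have "E (\<Sum>i<n. (x (Suc i) - x i) *\<^sub>R f (\<xi> i)) \<alpha>
        = (\<Sum>i<n. (x (Suc i) - x i) * E (f (\<xi> i)) \<alpha>)"
      unfolding endpoint_sum[OF E]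
      using tp by (intro sum.cong endpoint_scaleR[OF E]) (auto simp: tagged_partition_def)
    ultimately show "\<bar>E (\<Sum>i<n. (x (Suc i) - x i) *\<^sub>R f (\<xi> i)) \<alpha>
        - integral {a..b} (\<lambda>x. E (f x) \<alpha>)\<bar> \<le> \<epsilon>"
      using \<eta>(2) by linarith
  qed
qed

text \<open>The integral is constructed levelwise: the integrals of the endpoint functions are shown
  to satisfy the monotonicity and one-sided continuity conditions of
  \<open>ex_fuzzy_with_levels\<close>, and the resulting fuzzy number is then recognised as the
  limit of Riemann sums.\<close>

lemma ex_fuzzy_integral:
  fixes f :: "real \<Rightarrow> fuzzy"
  assumes "a \<le> b" "continuous_on {a..b} f"
  obtains I where "has_fuzzy_integral f I a b"
    "\<And>E \<alpha>. E \<in> {lower, upper} \<Longrightarrow> \<alpha> \<in> {0..1} \<Longrightarrow> E I \<alpha> = integral {a..b} (\<lambda>x. E (f x) \<alpha>)"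
proof -
  let ?F = "\<lambda>E \<alpha>. integral {a..b} (\<lambda>x. E (f x) \<alpha>)"
  have int: "(\<lambda>x. E (f x) \<alpha>) integrable_on {a..b}" if "E \<in> {lower, upper}" "\<alpha> \<in> {0..1}" for E \<alpha>
    by (intro integrable_continuous_interval continuous_on_endpoint[OF assms(2) that])
  \<comment> \<open>The semicontinuity properties of \<open>?F\<close> are inherited from Riemann sums, which approximate
    it uniformly in the level.\<close>
  have approx: "\<exists>u. \<forall>\<alpha>\<in>{0..1}. \<bar>lower u \<alpha> - ?F lower \<alpha>\<bar> \<le> e \<and> \<bar>upper u \<alpha> - ?F upper \<alpha>\<bar> \<le> e"
    if "0 < e" for e
  proof -
    obtain \<delta> where \<delta>: "0 < \<delta>"
      "\<And>n x \<xi> E \<alpha>. tagged_partition a b \<delta> n x \<xi> \<Longrightarrow> E \<in> {lower, upper} \<Longrightarrow> \<alpha> \<in> {0..1} \<Longrightarrow>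
        \<bar>E (\<Sum>i<n. (x (Suc i) - x i) *\<^sub>R f (\<xi> i)) \<alpha> - ?F E \<alpha>\<bar> \<le> e"
      using fuzzy_Riemann_sum_error[OF assms \<open>0 < e\<close>] by blast
    obtain n x \<xi> where "tagged_partition a b \<delta> n x \<xi>"
      using ex_tagged_partition[OF assms(1) \<delta>(1)] by blast
    from \<delta>(2)[OF this] show ?thesis by blast
  qed
  have "\<exists>!w. \<forall>\<alpha>\<in>{0..1}. level w \<alpha> = {?F lower \<alpha>..?F upper \<alpha>}"
  proof (rule ex_fuzzy_with_levels, goal_cases)
    case (1 \<alpha> \<beta>)
    then show ?case
      by (intro conjI integral_le int lower_upper_mono) auto
  next
    case 2
    then show ?case by (intro integral_le int level_eq_interval(1)) auto
  next
    case (3 \<alpha> e)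
    \<comment> \<open>One third pays for left continuity of the approximating fuzzy number
      \<open>u\<close>, the other two for replacing \<open>u\<close> by \<open>?F\<close> at the two
      levels.\<close>
    then have e: "0 < e / 3" by simp
    obtain u where u: "\<And>\<beta>. \<beta> \<in> {0..1} \<Longrightarrow>
        \<bar>lower u \<beta> - ?F lower \<beta>\<bar> \<le> e / 3 \<and> \<bar>upper u \<beta> - ?F upper \<beta>\<bar> \<le> e / 3"
      using approx[OF e] by blast
    obtain \<beta> where \<beta>: "0 < \<beta>" "\<beta> < \<alpha>" "lower u \<alpha> - e / 3 < lower u \<beta>"
      using lower_upper_left(1)[OF 3(1,2) e] by blast
    obtain \<gamma> where \<gamma>: "0 < \<gamma>" "\<gamma> < \<alpha>" "upper u \<gamma> < upper u \<alpha> + e / 3"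
      using lower_upper_left(2)[OF 3(1,2) e] by blast
    have "\<bar>lower u \<alpha> - ?F lower \<alpha>\<bar> \<le> e / 3" "\<bar>lower u \<beta> - ?F lower \<beta>\<bar> \<le> e / 3"
      "\<bar>upper u \<alpha> - ?F upper \<alpha>\<bar> \<le> e / 3" "\<bar>upper u \<gamma> - ?F upper \<gamma>\<bar> \<le> e / 3"
      using u[of \<alpha>] u[of \<beta>] u[of \<gamma>] \<beta> \<gamma> 3 by simp_all
    then have "?F lower \<alpha> - e < ?F lower \<beta>" "?F upper \<gamma> < ?F upper \<alpha> + e"
      using \<beta>(3) \<gamma>(3) by linarith+
    then show ?case using \<beta> \<gamma> by blast
  next
    case (4 e)
    then have e: "0 < e / 3" by simp
    obtain u where u: "\<And>\<beta>. \<beta> \<in> {0..1} \<Longrightarrow>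
        \<bar>lower u \<beta> - ?F lower \<beta>\<bar> \<le> e / 3 \<and> \<bar>upper u \<beta> - ?F upper \<beta>\<bar> \<le> e / 3"
      using approx[OF e] by blast
    obtain \<beta> where \<beta>: "0 < \<beta>" "\<beta> \<le> 1" "lower u \<beta> < lower u 0 + e / 3"
      using lower_upper_right_0(1)[OF e] by blast
    obtain \<gamma> where \<gamma>: "0 < \<gamma>" "\<gamma> \<le> 1" "upper u 0 - e / 3 < upper u \<gamma>"
      using lower_upper_right_0(2)[OF e] by blast
    have "\<bar>lower u 0 - ?F lower 0\<bar> \<le> e / 3" "\<bar>lower u \<beta> - ?F lower \<beta>\<bar> \<le> e / 3"
      "\<bar>upper u 0 - ?F upper 0\<bar> \<le> e / 3" "\<bar>upper u \<gamma> - ?F upper \<gamma>\<bar> \<le> e / 3"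
      using u[of 0] u[of \<beta>] u[of \<gamma>] \<beta> \<gamma> by simp_all
    then have "?F lower \<beta> < ?F lower 0 + e" "?F upper 0 - e < ?F upper \<gamma>"
      using \<beta>(3) \<gamma>(3) by linarith+
    then show ?case using \<beta> \<gamma> by blast
  qed
  then obtain I where I: "\<And>\<alpha>. \<alpha> \<in> {0..1} \<Longrightarrow> level I \<alpha> = {?F lower \<alpha>..?F upper \<alpha>}" by blast
  have F: "E I \<alpha> = ?F E \<alpha>" if "E \<in> {lower, upper}" "\<alpha> \<in> {0..1}" for E \<alpha>
  proof -
    have "?F lower \<alpha> \<le> ?F upper \<alpha>" using that(2) by (intro integral_le int level_eq_interval(1)) auto
    from endpoints_eqI[OF I[OF that(2)] this] show ?thesis using that(1) by auto
  qed
  have "has_fuzzy_integral f I a b"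
    unfolding has_fuzzy_integral_def
  proof (intro allI impI)
    fix \<epsilon> :: real assume "0 < \<epsilon>"
    \<comment> \<open>The supremum over levels preserves only non-strict bounds; halving \<epsilon>
      restores the strict one.\<close>
    then have "0 < \<epsilon> / 2" by simp
    from fuzzy_Riemann_sum_error[OF assms this] obtain \<delta> where \<delta>: "0 < \<delta>"
      "\<And>n x \<xi> E \<alpha>. tagged_partition a b \<delta> n x \<xi> \<Longrightarrow> E \<in> {lower, upper} \<Longrightarrow> \<alpha> \<in> {0..1} \<Longrightarrow>
        \<bar>E (\<Sum>i<n. (x (Suc i) - x i) *\<^sub>R f (\<xi> i)) \<alpha> - ?F E \<alpha>\<bar> \<le> \<epsilon> / 2"
      by blast
    have "dist (\<Sum>i<n. (x (Suc i) - x i) *\<^sub>R f (\<xi> i)) I \<le> \<epsilon> / 2"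
      if "tagged_partition a b \<delta> n x \<xi>" for n x \<xi>
      using \<delta>(2)[OF that] F by (intro dist_fuzzy_leI) simp
    then show "\<exists>\<delta>>0. \<forall>n x \<xi>. tagged_partition a b \<delta> n x \<xi> \<longrightarrow>
        dist (\<Sum>i<n. (x (Suc i) - x i) *\<^sub>R f (\<xi> i)) I < \<epsilon>"
      using \<delta>(1) \<open>0 < \<epsilon>\<close> by (intro exI[of _ \<delta>]) fastforce
  qed
  then show ?thesis using that F by blast
qed

section \<open>Endpoint formulas and continuity of the integral in its upper limit\<close>

lemma endpoint_fuzzy_integral:
  assumes "a \<le> b" "continuous_on {a..b} f" "E \<in> {lower, upper}" "\<alpha> \<in> {0..1}"
  shows "E (fuzzy_integral a b f) \<alpha> = integral {a..b} (\<lambda>x. E (f x) \<alpha>)"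
proof -
  obtain I where I: "has_fuzzy_integral f I a b"
    "\<And>E \<alpha>. E \<in> {lower, upper} \<Longrightarrow> \<alpha> \<in> {0..1} \<Longrightarrow> E I \<alpha> = integral {a..b} (\<lambda>x. E (f x) \<alpha>)"
    using ex_fuzzy_integral[OF assms(1,2)] by blast
  \<comment> \<open>Uniqueness identifies the definite description with the constructed
    integral.\<close>
  have "fuzzy_integral a b f = I"
    unfolding fuzzy_integral_def using I(1) has_fuzzy_integral_unique[OF assms(1)] by blast
  then show ?thesis using I(2)[OF assms(3,4)] by simp
qed

text \<open>Fuzzy addition lacks inverses in general, so the difference of two integrals is formed
  on real endpoints.\<close>

lemma endpoint_fuzzy_integral_diff:
  assumes "a \<le> b" "b \<le> c" "continuous_on {a..c} f" "E \<in> {lower, upper}" "\<alpha> \<in> {0..1}"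
  shows "E (fuzzy_integral b c f) \<alpha> = E (fuzzy_integral a c f) \<alpha> - E (fuzzy_integral a b f) \<alpha>"
proof -
  have cont: "continuous_on {a..b} f" "continuous_on {b..c} f"
    using assms by (auto intro: continuous_on_subset)
  have "(\<lambda>x. E (f x) \<alpha>) integrable_on {a..c}"
    by (intro integrable_continuous_interval continuous_on_endpoint[OF assms(3-5)])
  from Henstock_Kurzweil_Integration.integral_combine[OF assms(1,2) this] show ?thesis
    using cont assms by (simp only: endpoint_fuzzy_integral order_trans[OF assms(1,2)])
qed

text \<open>This makes \<open>s\<close> itself integrable. On a bounded interval \<open>f\<close> is
  bounded, so its integral is Lipschitz in the upper limit; continuity on the half-line follows
  locally.\<close>

lemma continuous_on_fuzzy_integral:
  fixes f :: "real \<Rightarrow> fuzzy"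
  assumes "continuous_on {a..} f"
  shows "continuous_on {a..} (\<lambda>t. fuzzy_integral a t f)"
proof -
  have cont: "continuous_on {c..d} f" if "a \<le> c" for c d
    using that by (intro continuous_on_subset[OF assms]) auto
  have "continuous_on {a..T} (\<lambda>t. fuzzy_integral a t f)" for T
  proof -
    have "bounded (f ` {a..T})"
      using cont by (intro compact_imp_bounded compact_continuous_image) auto
    \<comment> \<open>The distance to \<open>crisp 0\<close> dominates the absolute value of every
      endpoint at every level.\<close>
    then obtain M where M: "\<And>x. x \<in> {a..T} \<Longrightarrow> dist (crisp 0) (f x) \<le> M"
      unfolding bounded_any_center[of _ "crisp 0"] by blast
    have lip: "dist (fuzzy_integral a d f) (fuzzy_integral a c f) \<le> M * (d - c)"
      if cd: "a \<le> c" "c \<le> d" "d \<le> T" for c d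
    proof (rule dist_fuzzy_leI)
      fix E \<alpha> assume E: "E \<in> {lower, upper}" "\<alpha> \<in> {0..1::real}"
      have "norm (integral {c..d} (\<lambda>x. E (f x) \<alpha>)) \<le> M * (d - c)"
      proof (intro integral_bound continuous_on_endpoint[OF _ E] cont)
        fix x assume "x \<in> {c..d}"
        then show "norm (E (f x) \<alpha>) \<le> M"
          using endpoint_dist_le[OF E, of "crisp 0" "f x"] M[of x] cd
          by (simp add: endpoint_crisp[OF E])
      qed (use cd in auto)
      then show "\<bar>E (fuzzy_integral a d f) \<alpha> - E (fuzzy_integral a c f) \<alpha>\<bar> \<le> M * (d - c)"
        using endpoint_fuzzy_integral_diff[OF cd(1,2) cont E]
          endpoint_fuzzy_integral[OF cd(2) cont E] cd by simp
    qed
    have "M-lipschitz_on {a..T} (\<lambda>t. fuzzy_integral a t f)" if "a \<le> T"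
    proof (rule lipschitz_onI)
      fix c d assume "c \<in> {a..T}" "d \<in> {a..T}"
      then show "dist (fuzzy_integral a c f) (fuzzy_integral a d f) \<le> M * dist c d"
        using lip[of c d] lip[of d c]
        by (cases "c \<le> d") (auto simp: dist_real_def dist_commute)
    next
      show "0 \<le> M" using M[of a] that order_trans[OF zero_le_dist] by auto
    qed
    then show ?thesis by (cases "a \<le> T") (auto intro: lipschitz_on_continuous_on)
  qed
  \<comment> \<open>The bounded interval reaches beyond \<open>t\<close>, so both filters agree near
    \<open>t\<close> and continuity transfers to the half-line.\<close>
  moreover have "at t within {a..} = at t within {a..t + 1}" if "a \<le> t" for t
    by (rule at_within_nhd[where S="{..<t + 1}"]) auto
  ultimately show ?thesis
    unfolding continuous_on_def by (metis atLeast_iff atLeastAtMost_iff less_add_one less_imp_le)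
qed


section \<open>Moving averages\<close>

text \<open>Two parameters cover both averages of the theorem: \<open>p = 1\<close> yields those
  over intervals starting at \<open>t\<close>, \<open>q = 1\<close> those over intervals ending at
  \<open>t\<close>.\<close>

lemma tendsto_moving_average:
  fixes f s :: "real \<Rightarrow> fuzzy"
  assumes f: "continuous_on {0..} f" and s: "\<And>t. 0 \<le> t \<Longrightarrow> s t = fuzzy_integral 0 t f"
    and L: "cesaro_summable_to f L" and pq: "0 < p" "p < q"
  shows "((\<lambda>t. (1 / (q * t - p * t)) *\<^sub>R fuzzy_integral (p * t) (q * t) s) \<longlongrightarrow> L) at_top"
proof (rule tendstoI)
  let ?S = "\<lambda>t. fuzzy_integral 0 t f"
  have cS: "continuous_on {0..t} ?S" for t
    by (intro continuous_on_subset[OF continuous_on_fuzzy_integral[OF f]]) auto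
  \<comment> \<open>The function \<open>s\<close> is prescribed only at nonnegative arguments, so
    continuity is transferred from \<open>?S\<close> on \<open>{0..t}\<close>.\<close>
  have cs: "continuous_on {0..t} s" for t
    using cS[of t] by (rule continuous_on_eq) (simp add: s)
  have mean: "E (fuzzy_integral 0 t s) \<alpha> = t * E (cesaro_mean f t) \<alpha>"
    if "0 < t" "E \<in> {lower, upper}" "\<alpha> \<in> {0..1}" for t E \<alpha>
  proof -
    have "E (fuzzy_integral 0 t s) \<alpha> = E (fuzzy_integral 0 t ?S) \<alpha>"
      using that cs[of t] cS[of t]
      by (simp only: endpoint_fuzzy_integral less_imp_le) (auto simp: s intro: integral_cong)
    then show ?thesis using that by (simp add: cesaro_mean_def endpoint_scaleR)
  qed
  fix e :: real assume e: "0 < e"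
  \<comment> \<open>The means at \<open>q * t\<close> and \<open>p * t\<close> enter with weights
    \<open>q / (q - p)\<close> and \<open>- p / (q - p)\<close>; their absolute values sum to
    \<open>(q + p) / (q - p)\<close>, so this \<eta> gives a total error of
    \<open>e / 2\<close>.\<close>
  define \<eta> where "\<eta> = e / 2 * (q - p) / (q + p)"
  have "q + p \<noteq> 0" using pq by linarith
  then have *: "(q + p) * \<eta> = e / 2 * (q - p)"
    unfolding \<eta>_def times_divide_eq_right by (rule nonzero_mult_div_cancel_left)
  have \<eta>: "0 < \<eta>" using e pq by (simp add: \<eta>_def)
  have less: "(q + p) * \<eta> / (q - p) < e"
    unfolding * using e pq by (simp add: pos_divide_less_eq mult_strict_right_mono)
  have lim: "\<forall>\<^sub>F t in at_top. dist (cesaro_mean f t) L < \<eta>"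
    using tendstoD[OF L[unfolded cesaro_summable_to_def] \<eta>] .
  have near: "\<forall>\<^sub>F t in at_top. dist (cesaro_mean f (c * t)) L < \<eta>" if "0 < c" for c
    using filterlim_tendsto_pos_mult_at_top[OF tendsto_const that filterlim_ident] lim
    by (auto simp: filterlim_iff)
  have "0 < q" using pq by linarith
  show "\<forall>\<^sub>F t in at_top.
      dist ((1 / (q * t - p * t)) *\<^sub>R fuzzy_integral (p * t) (q * t) s) L < e"
    using near[OF pq(1)] near[OF \<open>0 < q\<close>] eventually_gt_at_top[of 0]
  proof eventually_elim
    case (elim t)
    have t: "0 < p * t" "p * t < q * t" "0 < q * t" using elim pq by auto
    have "dist ((1 / (q * t - p * t)) *\<^sub>R fuzzy_integral (p * t) (q * t) s) L
        \<le> (q + p) * \<eta> / (q - p)"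
    proof (rule dist_fuzzy_leI)
      fix E \<alpha> assume E: "E \<in> {lower, upper}" "\<alpha> \<in> {0..1::real}"
      define x where "x = E (cesaro_mean f (p * t)) \<alpha> - E L \<alpha>"
      define y where "y = E (cesaro_mean f (q * t)) \<alpha> - E L \<alpha>"
      have xy: "\<bar>x\<bar> \<le> \<eta>" "\<bar>y\<bar> \<le> \<eta>"
        using endpoint_dist_le[OF E, of "cesaro_mean f (p * t)" L]
          endpoint_dist_le[OF E, of "cesaro_mean f (q * t)" L] elim by (auto simp: x_def y_def)
      have "E ((1 / (q * t - p * t)) *\<^sub>R fuzzy_integral (p * t) (q * t) s) \<alpha>
          = (1 / (q * t - p * t)) * (q * t * (y + E L \<alpha>) - p * t * (x + E L \<alpha>))"
        using t endpoint_fuzzy_integral_diff[of 0 "p * t" "q * t" s, OF _ _ cs E]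
        by (simp add: endpoint_scaleR[OF E] mean[OF _ E] x_def y_def)
      \<comment> \<open>The factor \<open>t\<close> cancels and the weights of
        \<open>E L \<alpha>\<close> sum to 1, leaving only the deviations \<open>x\<close> and
        \<open>y\<close>.\<close>
      also have "\<dots> = (q * y - p * x) / (q - p) + E L \<alpha>"
      proof -
        have "q * t * (y + E L \<alpha>) - p * t * (x + E L \<alpha>)
            = t * ((q * y - p * x) + (q - p) * E L \<alpha>)" by (simp add: algebra_simps)
        moreover have "q * t - p * t = t * (q - p)" by (simp add: algebra_simps)
        ultimately show ?thesis using elim(3) pq by (simp add: add_divide_distrib)
      qed
      finally have "E ((1 / (q * t - p * t)) *\<^sub>R fuzzy_integral (p * t) (q * t) s) \<alpha> - E L \<alpha>
          = (q * y - p * x) / (q - p)" by simp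
      moreover have "\<bar>q * y - p * x\<bar> \<le> (q + p) * \<eta>"
      proof -
        have "\<bar>q * y\<bar> \<le> q * \<eta>" "\<bar>p * x\<bar> \<le> p * \<eta>"
          using xy pq by (auto simp: abs_mult intro: mult_left_mono)
        then show ?thesis by (simp add: distrib_right)
      qed
      ultimately show "\<bar>E ((1 / (q * t - p * t)) *\<^sub>R fuzzy_integral (p * t) (q * t) s) \<alpha> - E L \<alpha>\<bar>
          \<le> (q + p) * \<eta> / (q - p)"
        using pq by (simp add: divide_right_mono)
    qed
    then show ?case using less by linarith
  qed
qed

section \<open>Equivalence of convergence with the one-sided conditions\<close>

theorem theorem3p6:
  fixes f s :: "real \<Rightarrow> fuzzy" and L :: fuzzy
  assumes "continuous_on {0..} f"
    and "\<And>t. 0 \<le> t \<Longrightarrow> s t = fuzzy_integral 0 t f"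
    and "cesaro_summable_to f L"
  shows "integral_converges_to f L \<longleftrightarrow>
    (\<forall>\<epsilon>>0. \<exists>t0\<ge>0. \<exists>\<kappa>>1. \<exists>l>0. l < 1 \<and> (\<forall>t>t0.
       (1 / (\<kappa> * t - t)) *\<^sub>R fuzzy_integral t (\<kappa> * t) s \<ge> s t + crisp (- \<epsilon>) \<and>
       (1 / (t - l * t)) *\<^sub>R fuzzy_integral (l * t) t s \<le> s t + crisp \<epsilon>))"
proof -
  let ?A = "\<lambda>\<kappa> t. (1 / (\<kappa> * t - t)) *\<^sub>R fuzzy_integral t (\<kappa> * t) s"
  let ?B = "\<lambda>l t. (1 / (t - l * t)) *\<^sub>R fuzzy_integral (l * t) t s"
  have A: "(?A \<kappa> \<longlongrightarrow> L) at_top" if "1 < \<kappa>" for \<kappa>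
    using tendsto_moving_average[OF assms, of 1 \<kappa>] that by simp
  have B: "(?B l \<longlongrightarrow> L) at_top" if "0 < l" "l < 1" for l
    using tendsto_moving_average[OF assms, of l 1] that by simp
  have "(\<forall>\<^sub>F t in at_top. s t = fuzzy_integral 0 t f)"
    using eventually_ge_at_top[of 0] by eventually_elim (rule assms(2))
  then have conv: "integral_converges_to f L \<longleftrightarrow> (s \<longlongrightarrow> L) at_top"
    unfolding integral_converges_to_def by (intro tendsto_cong) (auto elim: eventually_mono)
  show ?thesis
    unfolding conv
  proof (intro iffI allI impI)
    fix \<epsilon> :: real assume s: "(s \<longlongrightarrow> L) at_top" and \<epsilon>: "0 < \<epsilon>"
    \<comment> \<open>All moving averages tend to \<open>L\<close>, so any admissible factors would
      serve; 2 and 1/2 are fixed independently of \<epsilon>.\<close>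
    have A2: "(?A 2 \<longlongrightarrow> L) at_top" and B2: "(?B (1/2) \<longlongrightarrow> L) at_top"
      using A[of 2] B[of "1/2"] by simp_all
    have "\<forall>\<^sub>F t in at_top. s t + crisp (- \<epsilon>) \<le> ?A 2 t \<and> ?B (1/2) t \<le> s t + crisp \<epsilon>"
      using tendstoD[OF s half_gt_zero[OF \<epsilon>]] tendstoD[OF A2 half_gt_zero[OF \<epsilon>]]
        tendstoD[OF B2 half_gt_zero[OF \<epsilon>]]
    proof eventually_elim
      case (elim t)
      then have "dist (?A 2 t) (s t) \<le> \<epsilon>" "dist (?B (1/2) t) (s t) \<le> \<epsilon>"
        using dist_triangle_half_l less_imp_le by blast+
      then show ?case by (intro conjI dist_le_imp_fuzzy_bounds)
    qed
    then obtain t1 where "\<And>t. t1 \<le> t \<Longrightarrow>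
        s t + crisp (- \<epsilon>) \<le> ?A 2 t \<and> ?B (1/2) t \<le> s t + crisp \<epsilon>"
      unfolding eventually_at_top_linorder by blast
    then show "\<exists>t0\<ge>0. \<exists>\<kappa>>1. \<exists>l>0. l < 1 \<and>
        (\<forall>t>t0. s t + crisp (- \<epsilon>) \<le> ?A \<kappa> t \<and> ?B l t \<le> s t + crisp \<epsilon>)"
      by (intro exI[of _ "max 0 t1"] exI[of _ 2] exI[of _ "1/2"] conjI) auto
  next
    assume *: "\<forall>\<epsilon>>0. \<exists>t0\<ge>0. \<exists>\<kappa>>1. \<exists>l>0. l < 1 \<and>
        (\<forall>t>t0. s t + crisp (- \<epsilon>) \<le> ?A \<kappa> t \<and> ?B l t \<le> s t + crisp \<epsilon>)"
    show "(s \<longlongrightarrow> L) at_top"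
    proof (rule tendstoI)
      fix \<epsilon> :: real assume "0 < \<epsilon>"
      \<comment> \<open>One third is the slack in the order conditions, one the distance of the
        averages from \<open>L\<close>; the last makes the final inequality strict.\<close>
      then have e: "0 < \<epsilon> / 3" by simp
      \<comment> \<open>The factors depend on \<epsilon> but not on \<open>t\<close>, so
        \<open>A\<close> and \<open>B\<close> apply to them.\<close>
      then obtain t0 \<kappa> l where kl: "1 < \<kappa>" "0 < l" "l < 1"
        and bounds: "\<And>t. t0 < t \<Longrightarrow>
          s t + crisp (- (\<epsilon> / 3)) \<le> ?A \<kappa> t \<and> ?B l t \<le> s t + crisp (\<epsilon> / 3)"
        using * by meson
      show "\<forall>\<^sub>F t in at_top. dist (s t) L < \<epsilon>"
        using tendstoD[OF A[OF kl(1)] e] tendstoD[OF B[OF kl(2,3)] e] eventually_gt_at_top[of t0]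
      proof eventually_elim
        case (elim t)
        then have "dist (s t) L \<le> \<epsilon> / 3 + \<epsilon> / 3"
          using bounds[of t] by (intro dist_le_between[of "s t" _ "?A \<kappa> t" "?B l t"]) auto
        then show ?case using e by linarith
      qed
    qed
  qed
qed

end
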